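(* Let $\Psi$ be a growth function of order $p\in(1/2,1]$. Then there exists a constant $B_{\Psi,p}>0$ such that $$\Big(\sum_{j=0}^\infty\Big(\frac{2^j}{\Psi^{-1}(2^j)}\Big)^2|f_{2^j}|^2\Big)^{1/2}\le B_{\Psi,p}\,\|F\|_{H^\Psi(\mathbb{D})}$$ for all functions $F(z)=\sum_{n=0}^\infty f_nz^n$ in $H^\Psi(\mathbb{D})$.
   Context: $\mathbb{D}$ is the open unit disc. Growth function of order $p\in(0,1]$: a function $\Psi:[0,\infty)\to[0,\infty)$ that is continuous and (strictly) increasing with $\Psi(0)=0$, $\lim_{t\to\infty}\Psi(t)=\infty$, such that $t\mapsto t^{-1}\Psi(t)$ is non-increasing on $(0,\infty)$, and of lower type $p$: there is $c>0$ with $\Psi(st)\le c\,s^p\,\Psi(t)$ for all $t\ge0$, $s\in(0,1)$. $\Psi^{-1}$ is the inverse function of $\Psi$. $H^\Psi(\mathbb{D})$ is the class of holomorphic $F$ on $\mathbb{D}$ with $\sup_{0\le r<1}\int_{[0,1)}\Psi(|F(re^{i2\pi\theta})|)\,d\theta<\infty$, with $$\|F\|_{H^\Psi(\mathbb{D})}=\inf\Big\{\alpha>0:\sup_{0\le r<1}\int_{[0,1)}\Psi(\alpha^{-1}|F(re^{i2\pi\theta})|)\,d\theta\le1\Big\}.$$ *)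

theory Defs
  imports "HOL-Complex_Analysis.Complex_Analysis"
begin

text \<open>
  Functions on \<open>[0,\<infinity>)\<close> are represented by total functions on the reals; only their
  values on \<open>{0..}\<close> matter.
\<close>

definition lower_type :: "real \<Rightarrow> (real \<Rightarrow> real) \<Rightarrow> bool" where
  "lower_type p \<Psi> \<longleftrightarrow>
     (\<exists>c>0. \<forall>t\<ge>0. \<forall>s\<in>{0<..<1}. \<Psi> (s * t) \<le> c * s powr p * \<Psi> t)"

definition growth_function :: "real \<Rightarrow> (real \<Rightarrow> real) \<Rightarrow> bool" where
  "growth_function p \<Psi> \<longleftrightarrow>
     p \<in> {0<..1} \<and>
     \<Psi> ` {0..} \<subseteq> {0..} \<and>
     continuous_on {0..} \<Psi> \<and>
     strict_mono_on {0..} \<Psi> \<and>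
     \<Psi> 0 = 0 \<and>
     filterlim \<Psi> at_top at_top \<and>
     antimono_on {0<..} (\<lambda>t. \<Psi> t / t) \<and>
     lower_type p \<Psi>"

definition growth_inv :: "(real \<Rightarrow> real) \<Rightarrow> real \<Rightarrow> real" where
  "growth_inv \<Psi> = inv_into {0..} \<Psi>"

definition circle_mean_sup :: "(real \<Rightarrow> real) \<Rightarrow> (complex \<Rightarrow> complex) \<Rightarrow> ennreal" where
  "circle_mean_sup \<Psi> F =
     (SUP r\<in>{0..<1::real}.
        \<integral>\<^sup>+\<theta>\<in>{0..<1::real}. ennreal (\<Psi> (norm (F (of_real r * cis (2 * pi * \<theta>))))) \<partial>lborel)"

definition hardy_orlicz :: "(real \<Rightarrow> real) \<Rightarrow> (complex \<Rightarrow> complex) set" where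
  "hardy_orlicz \<Psi> = {F. F holomorphic_on ball 0 1 \<and> circle_mean_sup \<Psi> F < \<infinity>}"

text \<open>
  For a growth function \<open>\<Psi>\<close> and \<open>F \<in> hardy_orlicz \<Psi>\<close> the set below is nonempty (by the
  lower type condition) and bounded below by \<open>0\<close>, so the real-valued infimum is the
  genuine one.
\<close>

definition hardy_orlicz_norm :: "(real \<Rightarrow> real) \<Rightarrow> (complex \<Rightarrow> complex) \<Rightarrow> real" where
  "hardy_orlicz_norm \<Psi> F =
     Inf {\<alpha>. \<alpha> > 0 \<and> circle_mean_sup \<Psi> (\<lambda>z. F z / of_real \<alpha>) \<le> 1}"

end

theory Submission
  imports Defs "HOL-Computational_Algebra.Fundamental_Theorem_Algebra"
begin

text \<open>
  The case \<open>\<Psi> t = t\<close> is Paley's inequality, whose classical proof writes \<open>F = g h\<close> with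
  \<open>\<bar>g\<bar>\<^sup>2 = \<bar>h\<bar>\<^sup>2 = \<bar>F\<bar>\<close> on the circle. In the coefficient
  \<open>f\<^sub>n = \<Sum>k\<le>n. g\<^sub>k h\<^sub>n\<^sub>-\<^sub>k\<close> at least one of the two indices lies in \<open>[n/2, n]\<close>, so by
  Cauchy-Schwarz \<open>\<bar>f\<^sub>n\<bar>\<^sup>2\<close> is at most \<open>2 D\<^sub>n(g) A\<^sub>n(h) + 2 A\<^sub>n(g) D\<^sub>n(h)\<close>, where \<open>A\<^sub>n\<close> is the sum of the
  squared coefficients up to \<open>n\<close> and \<open>D\<^sub>n\<close> the part of it with index at least \<open>n/2\<close>
  (\<open>convolution_norm_le\<close>). For \<open>n = 2\<^sup>j\<close> an index lies in at most two blocks, and Bessel's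
  inequality finishes the proof.

  For a general growth function put \<open>\<lambda>\<^sub>j = \<Psi>\<inverse>(2\<^sup>j)\<close> and \<open>w\<^sub>j = 2\<^sup>j / \<lambda>\<^sub>j\<close>; this weight is
  non-increasing because \<open>\<Psi> t / t\<close> is. Write \<open>A\<^sub>j\<close> and \<open>D\<^sub>j\<close> for the two sums at \<open>n = 2\<^sup>j\<close>. The same
  argument works once \<open>w\<^sub>N A\<^sub>N\<close> and \<open>\<Sum>j\<le>N. w\<^sub>j D\<^sub>j\<close> are bounded in terms of
  \<open>K = \<integral>\<Psi>(\<bar>g\<bar>\<^sup>2)\<close>, which is the integral of \<open>\<Psi>(\<bar>F\<bar>)\<close>. Summation by parts reduces both to a bound
  on \<open>\<Sum>j<N. (w\<^sub>j - w\<^sub>j\<^sub>+\<^sub>1) A\<^sub>j + w\<^sub>N A\<^sub>N\<close>, a sum with non-negative weights in which \<open>g\<close> may be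
  truncated at a height depending on \<open>j\<close> (\<open>weighted_energy_le\<close>). Where \<open>\<bar>g\<bar>\<^sup>2 \<le> \<lambda>\<^sub>j\<close>, Bessel's
  inequality is used, and the differences of the weights telescope pointwise to at most
  \<open>\<Psi>(\<bar>g\<bar>\<^sup>2)\<close> (\<open>abel_sum_truncation_le\<close>). Where \<open>\<bar>g\<bar>\<^sup>2 > \<lambda>\<^sub>j\<close>, each coefficient is at most the
  integral of \<open>\<bar>g\<bar>\<close>; the resulting sum over \<open>j\<close> is pointwise dominated by a geometric series with
  ratio \<open>2 powr (1 - 1/(2p))\<close>, which exceeds \<open>1\<close> exactly when \<open>p > 1/2\<close>
  (\<open>tail_constant_exists\<close>).

  It suffices to treat polynomials, since the Taylor polynomials of \<open>F(r z)\<close> converge boundedly on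
  the circle and then \<open>r\<close> tends to \<open>1\<close>. For a polynomial the factorization is explicit: each root
  contributes a linear factor that is split by hand (\<open>balanced_factorization_linear\<close>).
\<close>

section \<open>Summation by parts\<close>

text \<open>
  Abel's form of \<open>\<Sum>j\<le>N. w j * b j\<close> when \<open>a\<close> is the sequence of partial sums of \<open>b\<close>. It is defined for
  arbitrary \<open>a\<close>, because the partial sums are later replaced by upper bounds.
\<close>

definition abel_sum :: "(nat \<Rightarrow> real) \<Rightarrow> (nat \<Rightarrow> real) \<Rightarrow> nat \<Rightarrow> real" where
  "abel_sum w a N = (\<Sum>j<N. (w j - w (Suc j)) * a j) + w N * a N"

lemma abel_sum_partial_sums:
  "abel_sum w (\<lambda>j. \<Sum>i\<le>j. a i) N = (\<Sum>j\<le>N. w j * a j)"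
  by (induction N) (simp_all add: abel_sum_def algebra_simps)

lemma abel_sum_mono:
  assumes "decseq w" "\<And>j. 0 \<le> w j" "\<And>j. j \<le> N \<Longrightarrow> a j \<le> b j"
  shows "abel_sum w a N \<le> abel_sum w b N"
  unfolding abel_sum_def using assms decseq_SucD[OF assms(1)]
  by (intro add_mono sum_mono mult_left_mono) auto

lemma abel_sum_cmult: "abel_sum w (\<lambda>j. c * a j) N = c * abel_sum w a N"
  by (simp add: abel_sum_def sum_distrib_left algebra_simps)

lemma abel_sum_add: "abel_sum w (\<lambda>j. a j + b j) N = abel_sum w a N + abel_sum w b N"
  by (simp add: abel_sum_def sum.distrib distrib_left)

lemma abel_sum_le_weighted_sum:
  assumes "\<And>j. 0 \<le> w j" "\<And>j. 0 \<le> a j"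
  shows "abel_sum w a N \<le> (\<Sum>j\<le>N. w j * a j)"
proof -
  have "(\<Sum>j<N. (w j - w (Suc j)) * a j) \<le> (\<Sum>j<N. w j * a j)"
    using assms by (intro sum_mono mult_right_mono) auto
  thus ?thesis by (simp add: abel_sum_def lessThan_Suc_atMost[symmetric])
qed

lemma last_term_le_abel_sum:
  assumes "decseq w" "\<And>j. 0 \<le> a j"
  shows "w N * a N \<le> abel_sum w a N"
  unfolding abel_sum_def using assms(2) decseq_SucD[OF assms(1)]
  by (simp add: sum_nonneg)

text \<open>
  If \<open>i\<close> is the least index with \<open>P\<close>, replacing \<open>P j\<close> by \<open>i \<le> j\<close> only increases the sum, which then
  telescopes to \<open>w i * t\<close>.
\<close>

lemma abel_sum_step_le:
  assumes w: "decseq w" "\<And>j. 0 \<le> w j" and "0 \<le> t" "0 \<le> s"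
    and P: "\<And>j. P j \<Longrightarrow> w j * t \<le> s"
  shows "abel_sum w (\<lambda>j. if P j then t else 0) N \<le> s"
proof (cases "\<exists>j. P j")
  case True
  define i where "i = (LEAST j. P j)"
  have Pi: "P i" and least: "\<And>j. P j \<Longrightarrow> i \<le> j"
    unfolding i_def using True by (auto intro: LeastI_ex Least_le)
  have "abel_sum w (\<lambda>j. if P j then t else 0) N \<le> abel_sum w (\<lambda>j. \<Sum>k\<le>j. if k = i then t else 0) N"
    using w \<open>0 \<le> t\<close> least by (intro abel_sum_mono) auto
  also have "\<dots> = (\<Sum>j\<le>N. if j = i then w i * t else 0)"
    unfolding abel_sum_partial_sums by (intro sum.cong) auto
  also have "\<dots> \<le> s" using P[OF Pi] \<open>0 \<le> s\<close> by simp
  finally show ?thesis .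
qed (use \<open>0 \<le> s\<close> in \<open>simp add: abel_sum_def\<close>)

section \<open>Growth functions at dyadic levels\<close>

definition dyadic_level :: "(real \<Rightarrow> real) \<Rightarrow> nat \<Rightarrow> real" where
  "dyadic_level \<Psi> j = growth_inv \<Psi> (2 ^ j)"

definition paley_weight :: "(real \<Rightarrow> real) \<Rightarrow> nat \<Rightarrow> real" where
  "paley_weight \<Psi> j = 2 ^ j / dyadic_level \<Psi> j"

lemma growth_function_surj:
  assumes "growth_function p \<Psi>" "0 \<le> y"
  shows "y \<in> \<Psi> ` {0..}"
proof -
  have "filterlim \<Psi> at_top at_top" "\<Psi> 0 = 0" "continuous_on {0..} \<Psi>"
    using assms(1) by (auto simp: growth_function_def)
  then obtain x where x: "0 \<le> x" "y \<le> \<Psi> x"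
    using eventually_conj[OF eventually_ge_at_top[of 0], of "\<lambda>x. y \<le> \<Psi> x"]
    by (metis (no_types, lifting) eventually_at_top_linorder filterlim_at_top order_refl)
  have "continuous_on {0..x} \<Psi>"
    using \<open>continuous_on {0..} \<Psi>\<close> by (rule continuous_on_subset) auto
  then obtain z where "0 \<le> z" "\<Psi> z = y"
    using IVT'[of \<Psi> 0 y x] x \<open>\<Psi> 0 = 0\<close> assms(2) by auto
  thus ?thesis by auto
qed

lemma growth_function_nonneg:
  assumes "growth_function p \<Psi>" "0 \<le> t"
  shows "0 \<le> \<Psi> t"
  using assms by (force simp: growth_function_def)

lemma growth_function_le_iff:
  assumes "growth_function p \<Psi>" "0 \<le> s" "0 \<le> t"
  shows "\<Psi> s \<le> \<Psi> t \<longleftrightarrow> s \<le> t"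
  using assms strict_mono_on_less_eq[of "{0..}" \<Psi> s t] by (auto simp: growth_function_def)

lemma
  assumes "growth_function p \<Psi>"
  shows dyadic_level_eq: "\<Psi> (dyadic_level \<Psi> j) = 2 ^ j"
    and dyadic_level_pos: "0 < dyadic_level \<Psi> j"
proof -
  have "(2::real) ^ j \<in> \<Psi> ` {0..}" by (rule growth_function_surj[OF assms]) simp
  hence 1: "\<Psi> (dyadic_level \<Psi> j) = 2 ^ j" and "dyadic_level \<Psi> j \<in> {0..}"
    unfolding dyadic_level_def growth_inv_def by (rule f_inv_into_f, rule inv_into_into)
  moreover have "\<Psi> 0 = 0" using assms by (simp add: growth_function_def)
  ultimately show "\<Psi> (dyadic_level \<Psi> j) = 2 ^ j" "0 < dyadic_level \<Psi> j"
    by (auto simp: less_eq_real_def)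
qed

lemma growth_quotient_antimono:
  assumes "growth_function p \<Psi>" "0 < s" "s \<le> t"
  shows "\<Psi> t / t \<le> \<Psi> s / s"
proof -
  have "antimono_on {0<..} (\<lambda>t. \<Psi> t / t)" using assms(1) by (simp add: growth_function_def)
  thus ?thesis using assms(2,3) unfolding monotone_on_def by auto
qed

text \<open>
  The weight at \<open>j\<close> is the value of \<open>\<Psi> t / t\<close> at the increasing points \<open>t = dyadic_level \<Psi> j\<close>.
\<close>

lemma decseq_paley_weight:
  assumes "growth_function p \<Psi>"
  shows "decseq (paley_weight \<Psi>)"
proof (rule decseq_SucI)
  fix j
  have "dyadic_level \<Psi> j \<le> dyadic_level \<Psi> (Suc j)"
    using growth_function_le_iff[OF assms, of "dyadic_level \<Psi> j" "dyadic_level \<Psi> (Suc j)"]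
      dyadic_level_pos[OF assms] dyadic_level_eq[OF assms] by (simp add: less_imp_le)
  thus "paley_weight \<Psi> (Suc j) \<le> paley_weight \<Psi> j"
    using growth_quotient_antimono[OF assms dyadic_level_pos[OF assms, of j]]
    unfolding paley_weight_def dyadic_level_eq[OF assms, symmetric] by blast
qed

lemma paley_weight_pos:
  assumes "growth_function p \<Psi>"
  shows "0 < paley_weight \<Psi> j"
  by (simp add: paley_weight_def dyadic_level_pos[OF assms])

text \<open>
  With \<open>t = \<bar>g\<bar>\<^sup>2\<close> this is the contribution of a single point of the circle to the truncated parts
  of \<open>g\<close>. It is \<open>t\<close> times the weight at the first level above \<open>t\<close>, and that weight is at most
  \<open>\<Psi> t / t\<close>.
\<close>

lemma abel_sum_truncation_le:
  assumes "growth_function p \<Psi>" "0 \<le> t"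
  shows "abel_sum (paley_weight \<Psi>) (\<lambda>j. if t \<le> dyadic_level \<Psi> j then t else 0) N \<le> \<Psi> t"
proof (rule abel_sum_step_le)
  fix j assume le: "t \<le> dyadic_level \<Psi> j"
  show "paley_weight \<Psi> j * t \<le> \<Psi> t"
  proof (cases "t = 0")
    case False
    hence "paley_weight \<Psi> j \<le> \<Psi> t / t"
      using growth_quotient_antimono[OF assms(1) _ le] \<open>0 \<le> t\<close>
      by (simp add: paley_weight_def dyadic_level_eq[OF assms(1)])
    thus ?thesis using False \<open>0 \<le> t\<close> by (simp add: field_simps)
  qed (use growth_function_nonneg[OF assms] in auto)
qed (use assms decseq_paley_weight paley_weight_pos growth_function_nonneg less_imp_le in blast)+

lemma geometric_sum_le_last:
  fixes q :: real
  assumes "1 < q" "finite J" "0 \<le> y" "\<And>j. j \<in> J \<Longrightarrow> q ^ j \<le> y"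
  shows "(\<Sum>j\<in>J. q ^ j) \<le> q / (q - 1) * y"
proof (cases "J = {}")
  case False
  define m where "m = Max J"
  have m: "m \<in> J" "J \<subseteq> {..m}" using assms(2) False by (auto simp: m_def)
  have "(\<Sum>j\<in>J. q ^ j) \<le> (\<Sum>j\<le>m. q ^ j)"
    using m assms by (intro sum_mono2) auto
  also have "\<dots> = (q ^ Suc m - 1) / (q - 1)"
    using assms(1) by (simp only: lessThan_Suc_atMost[symmetric] geometric_sum)
  also have "\<dots> \<le> q / (q - 1) * q ^ m" using assms(1) by (simp add: field_simps)
  also have "\<dots> \<le> q / (q - 1) * y" using assms m by (intro mult_left_mono) auto
  finally show ?thesis .
qed (use assms in auto)

text \<open>
  With \<open>t = \<bar>g\<bar>\<^sup>2\<close> the bounded sum is the contribution of a single point of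
  the circle to the parts of \<open>g\<close> above the levels: since
  \<open>paley_weight \<Psi> j * 2 ^ j = (2 ^ j / sqrt (dyadic_level \<Psi> j))\<^sup>2\<close>, these parts enter through
  \<open>2 ^ j / sqrt (dyadic_level \<Psi> j) * \<bar>g\<bar>\<close>.
\<close>

definition tail_constant :: "(real \<Rightarrow> real) \<Rightarrow> real \<Rightarrow> bool" where
  "tail_constant \<Psi> C \<longleftrightarrow> C \<ge> 0 \<and> (\<forall>t\<ge>0. \<forall>N. (\<Sum>j\<le>N. if dyadic_level \<Psi> j < t
     then 2 ^ j * sqrt (t / dyadic_level \<Psi> j) else 0) \<le> C * \<Psi> t)"

text \<open>
  For a level \<open>l < t\<close> with \<open>\<Psi> l = 2 ^ j\<close>, the lower type condition gives
  \<open>2 ^ j \<le> c * (l / t) powr p * \<Psi> t\<close>, which bounds \<open>sqrt (t / l)\<close> by a constant times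
  \<open>(\<Psi> t / 2 ^ j) powr \<gamma>\<close> with \<open>\<gamma> = 1 / (2 * p)\<close>. As \<open>\<gamma> < 1\<close>, the terms grow geometrically in
  \<open>j\<close>, and the last one has \<open>2 ^ j \<le> \<Psi> t\<close>.
\<close>

lemma tail_constant_exists:
  assumes gf: "growth_function p \<Psi>" and "1/2 < p"
  shows "\<exists>C. tail_constant \<Psi> C"
proof -
  obtain c where c: "c > 0" "\<And>t s. t \<ge> 0 \<Longrightarrow> s \<in> {0<..<1} \<Longrightarrow> \<Psi> (s * t) \<le> c * s powr p * \<Psi> t"
    using gf by (auto simp: growth_function_def lower_type_def)
  define \<gamma> where "\<gamma> = 1 / (2 * p)"
  have \<gamma>: "0 < \<gamma>" "\<gamma> < 1" using \<open>1/2 < p\<close> by (auto simp: \<gamma>_def field_simps)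
  define q :: real where "q = 2 powr (1 - \<gamma>)"
  have q: "1 < q" using \<gamma> by (simp add: q_def)
  define C where "C = c powr \<gamma> * (q / (q - 1))"
  show ?thesis
    unfolding tail_constant_def
  proof (intro exI[of _ C] conjI allI impI)
    show "0 \<le> C" using q by (simp add: C_def)
    fix t :: real and N :: nat assume "0 \<le> t"
    have \<Psi>0: "0 \<le> \<Psi> t" by (rule growth_function_nonneg[OF gf \<open>0 \<le> t\<close>])
    define J where "J = {j\<in>{..N}. dyadic_level \<Psi> j < t}"
    have term_le: "2 ^ j * sqrt (t / dyadic_level \<Psi> j) \<le> c powr \<gamma> * \<Psi> t powr \<gamma> * q ^ j"
      and small: "q ^ j \<le> \<Psi> t powr (1 - \<gamma>)" if "j \<in> J" for j
    proof -
      define l where "l = dyadic_level \<Psi> j"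
      have l: "0 < l" "l < t" using that dyadic_level_pos[OF gf] by (auto simp: J_def l_def)
      have "2 ^ j = \<Psi> (l / t * t)" using l dyadic_level_eq[OF gf] by (simp add: l_def)
      also have "\<dots> \<le> c * (l / t) powr p * \<Psi> t" using l by (intro c) auto
      finally have "2 ^ j * (t / l) powr p \<le> c * \<Psi> t"
        using l by (simp add: powr_divide field_simps)
      hence "(t / l) powr p \<le> c * \<Psi> t / 2 ^ j" by (simp add: field_simps)
      hence "((t / l) powr p) powr \<gamma> \<le> (c * \<Psi> t / 2 ^ j) powr \<gamma>"
        using \<gamma> by (intro powr_mono2) auto
      also have "((t / l) powr p) powr \<gamma> = sqrt (t / l)"
        using l \<open>1/2 < p\<close> by (simp add: powr_powr \<gamma>_def powr_half_sqrt)
      also have "(c * \<Psi> t / 2 ^ j) powr \<gamma> = c powr \<gamma> * \<Psi> t powr \<gamma> / 2 powr (j * \<gamma>)"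
        using c(1) \<Psi>0 by (simp add: powr_mult powr_divide powr_powr powr_realpow[symmetric])
      finally have "2 ^ j * sqrt (t / l) \<le> 2 ^ j * (c powr \<gamma> * \<Psi> t powr \<gamma> / 2 powr (j * \<gamma>))"
        by (rule mult_left_mono) simp
      moreover have "(2::real) ^ j = q ^ j * 2 powr (j * \<gamma>)"
        by (simp add: q_def powr_realpow[symmetric] powr_powr powr_add[symmetric] algebra_simps)
      hence "2 ^ j * (c powr \<gamma> * \<Psi> t powr \<gamma> / 2 powr (j * \<gamma>)) = c powr \<gamma> * \<Psi> t powr \<gamma> * q ^ j"
        by simp
      ultimately show "2 ^ j * sqrt (t / dyadic_level \<Psi> j) \<le> c powr \<gamma> * \<Psi> t powr \<gamma> * q ^ j"
        by (simp add: l_def)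
      have "2 ^ j \<le> \<Psi> t"
        using growth_function_le_iff[OF gf, of l t] l dyadic_level_eq[OF gf, of j] by (simp add: l_def)
      hence "(2 ^ j) powr (1 - \<gamma>) \<le> \<Psi> t powr (1 - \<gamma>)" using \<gamma> by (intro powr_mono2) auto
      thus "q ^ j \<le> \<Psi> t powr (1 - \<gamma>)"
        by (simp add: q_def powr_power powr_powr powr_realpow[symmetric] mult_ac)
    qed
    have "(\<Sum>j\<le>N. if dyadic_level \<Psi> j < t then 2 ^ j * sqrt (t / dyadic_level \<Psi> j) else 0)
        = (\<Sum>j\<in>J. 2 ^ j * sqrt (t / dyadic_level \<Psi> j))"
      unfolding J_def by (rule sum.inter_filter[symmetric]) simp
    also have "\<dots> \<le> (\<Sum>j\<in>J. c powr \<gamma> * \<Psi> t powr \<gamma> * q ^ j)" by (intro sum_mono term_le)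
    also have "\<dots> \<le> c powr \<gamma> * \<Psi> t powr \<gamma> * (q / (q - 1) * \<Psi> t powr (1 - \<gamma>))"
      unfolding sum_distrib_left[symmetric]
      by (intro mult_left_mono geometric_sum_le_last q small) (auto simp: J_def)
    also have "\<dots> = C * \<Psi> t"
      using \<Psi>0 by (cases "\<Psi> t = 0") (auto simp: C_def powr_add[symmetric])
    finally show "(\<Sum>j\<le>N. if dyadic_level \<Psi> j < t
            then 2 ^ j * sqrt (t / dyadic_level \<Psi> j) else 0) \<le> C * \<Psi> t" .
  qed
qed

section \<open>Weighted sums of Fourier coefficients\<close>

lemma borel_measurable_cnj [measurable]:
  "f \<in> borel_measurable N \<Longrightarrow> (\<lambda>x. cnj (f x)) \<in> borel_measurable N"
  by (rule borel_measurable_continuous_on) (auto intro: continuous_intros)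

text \<open>
  The properties of the characters of the circle on which the coefficient estimates rest. The
  pointwise bound by \<open>1\<close> is what makes the \<open>L\<^sup>1\<close> estimate of a coefficient possible.
\<close>

locale orthonormal_sequence = finite_measure M for M :: "'a measure" +
  fixes e :: "nat \<Rightarrow> 'a \<Rightarrow> complex"
  assumes measurable_e [measurable]: "e k \<in> borel_measurable M"
    and norm_e_le: "x \<in> space M \<Longrightarrow> cmod (e k x) \<le> 1"
    and orthonormal: "(\<integral>x. e j x * cnj (e k x) \<partial>M) = (if j = k then 1 else 0)"
begin

definition coef :: "('a \<Rightarrow> complex) \<Rightarrow> nat \<Rightarrow> complex" where
  "coef u k = (\<integral>x. u x * cnj (e k x) \<partial>M)"

lemma integrable_bounded:
  fixes f :: "'a \<Rightarrow> 'b :: {banach, second_countable_topology}"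
  assumes "f \<in> borel_measurable M" "\<And>x. x \<in> space M \<Longrightarrow> norm (f x) \<le> B"
  shows "integrable M f"
  using assms by (intro integrable_const_bound[of _ B]) auto

lemma integrable_mult_e:
  assumes [measurable]: "u \<in> borel_measurable M" and "\<And>x. x \<in> space M \<Longrightarrow> cmod (u x) \<le> B"
  shows "integrable M (\<lambda>x. u x * cnj (e k x))"
proof (rule integrable_bounded)
  fix x assume x: "x \<in> space M"
  have "cmod (u x) * cmod (e k x) \<le> B * 1"
    using assms(2)[OF x] norm_e_le[OF x, of k] norm_ge_zero[of "u x"]
    by (intro mult_mono) (linarith | simp)+
  thus "norm (u x * cnj (e k x)) \<le> B" by (simp add: norm_mult)
qed measurable

lemma bessel_inequality:
  assumes [measurable]: "u \<in> borel_measurable M" and B: "\<And>x. x \<in> space M \<Longrightarrow> cmod (u x) \<le> B"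
    and "finite K"
  shows "(\<Sum>k\<in>K. (cmod (coef u k))\<^sup>2) \<le> (\<integral>x. (cmod (u x))\<^sup>2 \<partial>M)"
proof -
  note [simp] = integrable_mult_e[OF assms(1) B]
  have [simp]: "integrable M (\<lambda>x. e j x * cnj (e k x))" for j k
    by (rule integrable_mult_e[where B = 1]) (auto simp: norm_e_le)
  have [simp]: "integrable M (\<lambda>x. u x * cnj (u x))"
  proof (rule integrable_bounded)
    fix x assume x: "x \<in> space M"
    have "cmod (u x) * cmod (u x) \<le> B * B"
      using B[OF x] norm_ge_zero[of "u x"] by (intro mult_mono) (linarith | simp)+
    thus "norm (u x * cnj (u x)) \<le> B * B" by (simp add: norm_mult)
  qed measurable
  define c where "c = coef u"
  define S where "S = (\<lambda>x. \<Sum>k\<in>K. c k * e k x)"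
  have expand: "complex_of_real ((cmod (u x - S x))\<^sup>2) = u x * cnj (u x)
      - (\<Sum>k\<in>K. cnj (c k) * (u x * cnj (e k x))) - (\<Sum>k\<in>K. c k * cnj (u x * cnj (e k x)))
      + (\<Sum>j\<in>K. \<Sum>k\<in>K. c j * cnj (c k) * (e j x * cnj (e k x)))" for x
    unfolding complex_norm_square S_def
    by (simp add: algebra_simps sum_distrib_left sum_distrib_right cnj_sum, subst sum.swap, rule refl)
  have "complex_of_real (\<integral>x. (cmod (u x - S x))\<^sup>2 \<partial>M)
      = (\<integral>x. u x * cnj (u x) \<partial>M) - (\<Sum>k\<in>K. cnj (c k) * c k) - (\<Sum>k\<in>K. c k * cnj (c k))
      + (\<Sum>j\<in>K. \<Sum>k\<in>K. c j * cnj (c k) * (if j = k then 1 else 0))"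
    unfolding integral_complex_of_real[symmetric] expand
    by (simp add: Bochner_Integration.integral_diff Bochner_Integration.integral_add
      Bochner_Integration.integral_sum orthonormal integral_cnj c_def coef_def
      del: complex_cnj_mult)
  also have "\<dots> = (\<integral>x. u x * cnj (u x) \<partial>M) - (\<Sum>k\<in>K. c k * cnj (c k))"
    using \<open>finite K\<close> by (simp add: mult_ac if_distrib sum.delta cong: if_cong)
  also have "\<dots> = complex_of_real ((\<integral>x. (cmod (u x))\<^sup>2 \<partial>M) - (\<Sum>k\<in>K. (cmod (c k))\<^sup>2))"
    unfolding complex_norm_square[symmetric] integral_complex_of_real by simp
  finally have "(\<integral>x. (cmod (u x - S x))\<^sup>2 \<partial>M) = (\<integral>x. (cmod (u x))\<^sup>2 \<partial>M) - (\<Sum>k\<in>K. (cmod (c k))\<^sup>2)"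
    by (simp only: of_real_eq_iff)
  moreover have "0 \<le> (\<integral>x. (cmod (u x - S x))\<^sup>2 \<partial>M)" by simp
  ultimately show ?thesis by (simp add: c_def)
qed

lemma norm_coef_le:
  assumes [measurable]: "u \<in> borel_measurable M" and B: "\<And>x. x \<in> space M \<Longrightarrow> cmod (u x) \<le> B"
  shows "cmod (coef u k) \<le> (\<integral>x. cmod (u x) \<partial>M)"
proof -
  have "cmod (coef u k) \<le> (\<integral>x. cmod (u x * cnj (e k x)) \<partial>M)"
    unfolding coef_def by (rule integral_norm_bound)
  also have "\<dots> \<le> (\<integral>x. cmod (u x) \<partial>M)"
  proof (rule integral_mono)
    show "integrable M (\<lambda>x. cmod (u x * cnj (e k x)))"
      by (rule integrable_norm[OF integrable_mult_e[OF assms]])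
    show "integrable M (\<lambda>x. cmod (u x))"
      by (rule integrable_norm[OF integrable_bounded[OF assms]])
  qed (auto simp: norm_mult norm_e_le intro: mult_left_le)
  finally show ?thesis .
qed

text \<open>
  Bessel's inequality is used on the part of \<open>u\<close> where \<open>P\<close> holds. The other part can have a large
  \<open>L\<^sup>2\<close> norm, so there each of the \<open>n + 1\<close> coefficients is bounded by the \<open>L\<^sup>1\<close> norm instead.
\<close>

lemma partial_energy_le_split:
  assumes [measurable]: "u \<in> borel_measurable M" and B: "\<And>x. x \<in> space M \<Longrightarrow> cmod (u x) \<le> B"
    and [measurable]: "Measurable.pred M P"
  shows "(\<Sum>k\<le>n. (cmod (coef u k))\<^sup>2) \<le> 2 * (\<integral>x. (if P x then (cmod (u x))\<^sup>2 else 0) \<partial>M)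
           + 2 * real (Suc n) * (\<integral>x. (if P x then 0 else cmod (u x)) \<partial>M)\<^sup>2"
proof -
  define b where "b = (\<lambda>x. if P x then u x else 0)"
  define h where "h = (\<lambda>x. if P x then 0 else u x)"
  have [measurable]: "b \<in> borel_measurable M" "h \<in> borel_measurable M"
    by (auto simp: b_def h_def)
  have bB: "cmod (b x) \<le> \<bar>B\<bar>" and hB: "cmod (h x) \<le> \<bar>B\<bar>" if "x \<in> space M" for x
    using B[OF that] by (auto simp: b_def h_def)
  have "coef u k = coef b k + coef h k" for k
    unfolding coef_def
    by (subst Bochner_Integration.integral_add[symmetric])
       (auto simp: b_def h_def intro!: integrable_mult_e[where B = "\<bar>B\<bar>"] bB[unfolded b_def]
          hB[unfolded h_def] Bochner_Integration.integral_cong)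
  hence "(cmod (coef u k))\<^sup>2 \<le> 2 * (cmod (coef b k))\<^sup>2 + 2 * (cmod (coef h k))\<^sup>2" for k
    using power_mono[OF norm_triangle_ineq[of "coef b k" "coef h k"], of 2]
      sum_squares_bound[of "cmod (coef b k)" "cmod (coef h k)"]
    by (simp add: power2_sum)
  hence "(\<Sum>k\<le>n. (cmod (coef u k))\<^sup>2)
      \<le> 2 * (\<Sum>k\<le>n. (cmod (coef b k))\<^sup>2) + 2 * (\<Sum>k\<le>n. (cmod (coef h k))\<^sup>2)"
    by (simp add: sum_distrib_left sum.distrib[symmetric] sum_mono)
  also have "(\<Sum>k\<le>n. (cmod (coef b k))\<^sup>2) \<le> (\<integral>x. (cmod (b x))\<^sup>2 \<partial>M)"
    by (rule bessel_inequality) (auto intro: bB)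
  also have "(\<Sum>k\<le>n. (cmod (coef h k))\<^sup>2) \<le> (\<Sum>k\<le>n. (\<integral>x. cmod (h x) \<partial>M)\<^sup>2)"
    by (intro sum_mono power_mono norm_coef_le) (auto intro: hB)
  finally show ?thesis
    by (simp add: b_def h_def if_distrib[of cmod] if_distrib[of "\<lambda>y. y\<^sup>2"] algebra_simps cong: if_cong)
qed

text \<open>
  The central estimate. Splitting \<open>u\<close> at the level \<open>\<bar>u\<bar>\<^sup>2 = dyadic_level \<Psi> j\<close> in the \<open>j\<close>-th term is
  possible because, after summation by parts, all terms carry non-negative weights and each
  involves a full initial segment of coefficients.
\<close>

lemma weighted_energy_le:
  assumes gf: "growth_function p \<Psi>"
    and C: "tail_constant \<Psi> C"
    and [measurable]: "u \<in> borel_measurable M" and B: "\<And>x. x \<in> space M \<Longrightarrow> cmod (u x) \<le> B"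
    and int: "integrable M (\<lambda>x. \<Psi> ((cmod (u x))\<^sup>2))"
    and K: "(\<integral>x. \<Psi> ((cmod (u x))\<^sup>2) \<partial>M) \<le> K"
  shows "abel_sum (paley_weight \<Psi>) (\<lambda>j. \<Sum>k\<le>2 ^ j. (cmod (coef u k))\<^sup>2) N \<le> 2 * K + 4 * (C * K)\<^sup>2"
proof -
  define lam where "lam = dyadic_level \<Psi>"
  define w where "w = paley_weight \<Psi>"
  have lam: "0 < lam j" for j using dyadic_level_pos[OF gf] by (simp add: lam_def)
  have w: "decseq w" "0 \<le> w j" for j
    using decseq_paley_weight[OF gf] paley_weight_pos[OF gf] by (auto simp: w_def less_imp_le)
  define low where "low = (\<lambda>j x. if (cmod (u x))\<^sup>2 \<le> lam j then (cmod (u x))\<^sup>2 else 0)"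
  define high where "high = (\<lambda>j x. if (cmod (u x))\<^sup>2 \<le> lam j then 0 else cmod (u x))"
  have [measurable]: "low j \<in> borel_measurable M" "high j \<in> borel_measurable M" for j
    by (auto simp: low_def high_def)
  have [simp]: "integrable M (low j)" for j
    using lam[of j] by (intro integrable_bounded[where B = "lam j"]) (auto simp: low_def)
  have [simp]: "integrable M (high j)" for j
    using B by (intro integrable_bounded[where B = "\<bar>B\<bar>"]) (force simp: high_def)+
  define I where "I j = (\<integral>x. high j x \<partial>M)" for j
  have I0: "0 \<le> I j" for j unfolding I_def by (intro Bochner_Integration.integral_nonneg) (auto simp: high_def)

  have "abel_sum w (\<lambda>j. \<Sum>k\<le>2 ^ j. (cmod (coef u k))\<^sup>2) N
      \<le> abel_sum w (\<lambda>j. 2 * (\<integral>x. low j x \<partial>M) + 4 * (2 ^ j * (I j)\<^sup>2)) N"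
  proof (rule abel_sum_mono[OF w])
    fix j
    have "(\<Sum>k\<le>2 ^ j. (cmod (coef u k))\<^sup>2) \<le> 2 * (\<integral>x. low j x \<partial>M) + 2 * real (Suc (2 ^ j)) * (I j)\<^sup>2"
      unfolding low_def high_def I_def by (rule partial_energy_le_split) (auto intro: B)
    also have "2 * real (Suc (2 ^ j)) * (I j)\<^sup>2 \<le> 4 * 2 ^ j * (I j)\<^sup>2"
      by (intro mult_right_mono) auto
    finally show "(\<Sum>k\<le>2 ^ j. (cmod (coef u k))\<^sup>2) \<le> 2 * (\<integral>x. low j x \<partial>M) + 4 * (2 ^ j * (I j)\<^sup>2)"
      by (simp add: mult_ac)
  qed
  also have "\<dots> = 2 * abel_sum w (\<lambda>j. \<integral>x. low j x \<partial>M) N + 4 * abel_sum w (\<lambda>j. 2 ^ j * (I j)\<^sup>2) N"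
    by (simp only: abel_sum_add abel_sum_cmult)
  also have "abel_sum w (\<lambda>j. \<integral>x. low j x \<partial>M) N \<le> K"
  proof -
    have "abel_sum w (\<lambda>j. \<integral>x. low j x \<partial>M) N = (\<integral>x. abel_sum w (\<lambda>j. low j x) N \<partial>M)"
      by (simp add: abel_sum_def)
    also have "\<dots> \<le> (\<integral>x. \<Psi> ((cmod (u x))\<^sup>2) \<partial>M)"
    proof (rule integral_mono[OF _ int])
      show "integrable M (\<lambda>x. abel_sum w (\<lambda>j. low j x) N)" by (simp add: abel_sum_def)
      show "abel_sum w (\<lambda>j. low j x) N \<le> \<Psi> ((cmod (u x))\<^sup>2)" for x
        unfolding w_def low_def lam_def by (rule abel_sum_truncation_le[OF gf]) simp
    qed
    finally show ?thesis using K by linarith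
  qed
  also have "abel_sum w (\<lambda>j. 2 ^ j * (I j)\<^sup>2) N \<le> (C * K)\<^sup>2"
  proof -
    have "abel_sum w (\<lambda>j. 2 ^ j * (I j)\<^sup>2) N \<le> (\<Sum>j\<le>N. w j * (2 ^ j * (I j)\<^sup>2))"
      by (rule abel_sum_le_weighted_sum) (auto simp: w)
    also have "\<dots> = (\<Sum>j\<le>N. (2 ^ j * I j / sqrt (lam j))\<^sup>2)"
      using lam by (intro sum.cong) (auto simp: w_def paley_weight_def lam_def power_mult_distrib
          power_divide less_imp_le power2_eq_square)
    \<comment> \<open>A square sum is at most the square of the sum, and the sum can be taken inside the integral.\<close>
    also have "\<dots> \<le> (\<Sum>j\<le>N. 2 ^ j * I j / sqrt (lam j))\<^sup>2"
      using L2_set_le_sum[of "{..N}" "\<lambda>j. 2 ^ j * I j / sqrt (lam j)"] I0 lam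
      by (intro sqrt_le_D) (auto simp: L2_set_def less_imp_le)
    also have "(\<Sum>j\<le>N. 2 ^ j * I j / sqrt (lam j)) = (\<integral>x. (\<Sum>j\<le>N. 2 ^ j / sqrt (lam j) * high j x) \<partial>M)"
      by (simp add: I_def)
    also have "(\<integral>x. (\<Sum>j\<le>N. 2 ^ j / sqrt (lam j) * high j x) \<partial>M)\<^sup>2 \<le> (C * K)\<^sup>2"
    proof (rule power_mono)
      have "(\<integral>x. (\<Sum>j\<le>N. 2 ^ j / sqrt (lam j) * high j x) \<partial>M) \<le> (\<integral>x. C * \<Psi> ((cmod (u x))\<^sup>2) \<partial>M)"
      proof (rule integral_mono)
        fix x
        have "2 ^ j / sqrt (lam j) * high j x = (if lam j < (cmod (u x))\<^sup>2
            then 2 ^ j * sqrt ((cmod (u x))\<^sup>2 / lam j) else 0)" for j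
          by (simp add: high_def real_sqrt_divide)
        thus "(\<Sum>j\<le>N. 2 ^ j / sqrt (lam j) * high j x) \<le> C * \<Psi> ((cmod (u x))\<^sup>2)"
          using C by (simp only: tail_constant_def lam_def zero_le_power2)
      qed (use int in auto)
      also have "\<dots> \<le> C * K" using K C int by (simp add: mult_left_mono tail_constant_def)
      finally show "(\<integral>x. (\<Sum>j\<le>N. 2 ^ j / sqrt (lam j) * high j x) \<partial>M) \<le> C * K" .
      show "0 \<le> (\<integral>x. (\<Sum>j\<le>N. 2 ^ j / sqrt (lam j) * high j x) \<partial>M)"
        using lam by (intro Bochner_Integration.integral_nonneg sum_nonneg mult_nonneg_nonneg)
          (auto simp: high_def less_imp_le)
    qed
    finally show ?thesis .
  qed
  finally show ?thesis by (simp add: w_def)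
qed

end

section \<open>Factorization of polynomials\<close>

definition disc_algebra :: "(complex \<Rightarrow> complex) set" where
  "disc_algebra = {g. continuous_on (cball 0 1) g \<and> g holomorphic_on ball 0 1}"

text \<open>
  Both factors have modulus \<open>\<bar>F\<bar>\<close> to the power one half on the circle, as in the factorization of an
  \<open>H\<^sup>1\<close> function into two \<open>H\<^sup>2\<close> functions.
\<close>

definition balanced_factorization ::
    "(complex \<Rightarrow> complex) \<Rightarrow> (complex \<Rightarrow> complex) \<Rightarrow> (complex \<Rightarrow> complex) \<Rightarrow> bool" where
  "balanced_factorization F g h \<longleftrightarrow> g \<in> disc_algebra \<and> h \<in> disc_algebra \<and>
     (\<forall>z\<in>cball 0 1. F z = g z * h z) \<and>
     (\<forall>z\<in>sphere 0 1. (cmod (g z))\<^sup>2 = cmod (F z) \<and> (cmod (h z))\<^sup>2 = cmod (F z))"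

lemma disc_algebra_mult:
  assumes "g \<in> disc_algebra" "h \<in> disc_algebra"
  shows "(\<lambda>z. g z * h z) \<in> disc_algebra"
  using assms unfolding disc_algebra_def by (auto intro: continuous_on_mult holomorphic_on_mult)

lemma balanced_factorization_mult:
  assumes "balanced_factorization F g h" "balanced_factorization G k l"
  shows "balanced_factorization (\<lambda>z. F z * G z) (\<lambda>z. g z * k z) (\<lambda>z. h z * l z)"
  using assms unfolding balanced_factorization_def
  by (auto simp: disc_algebra_mult norm_mult power_mult_distrib)

text \<open>
  The closed half plane meets the branch cut only at \<open>0\<close>, where continuity follows from the modulus.
  This point is needed for polynomials with roots on the unit circle.
\<close>

lemma continuous_on_csqrt_right_half_plane: "continuous_on {z. 0 \<le> Re z} csqrt"
  unfolding continuous_on_eq_continuous_within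
proof
  fix z :: complex assume "z \<in> {z. 0 \<le> Re z}"
  show "continuous (at z within {z. 0 \<le> Re z}) csqrt"
  proof (cases "z = 0")
    case True
    have "((\<lambda>w. sqrt (cmod w)) \<longlongrightarrow> sqrt (cmod 0)) (at 0 within {z. 0 \<le> Re z})"
      by (intro tendsto_intros)
    hence "((\<lambda>w. cmod (csqrt w)) \<longlongrightarrow> 0) (at 0 within {z. 0 \<le> Re z})"
      by simp
    hence "(csqrt \<longlongrightarrow> 0) (at 0 within {z. 0 \<le> Re z})"
      by (rule tendsto_norm_zero_cancel)
    thus ?thesis using True by (simp add: continuous_within)
  next
    case False
    hence "z \<notin> \<real>\<^sub>\<le>\<^sub>0"
      using \<open>z \<in> _\<close> by (auto simp: complex_nonpos_Reals_iff complex_eq_iff)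
    thus ?thesis by (rule continuous_within_csqrt)
  qed
qed

lemma csqrt_linear_in_disc_algebra:
  assumes "cmod b \<le> 1"
  shows "(\<lambda>z. csqrt (1 - b * z)) \<in> disc_algebra"
proof -
  have Re: "0 \<le> Re (1 - b * z)" if "cmod z \<le> 1" for z
    using complex_Re_le_cmod[of "b * z"] mult_mono[OF assms that] by (simp add: norm_mult)
  have pos: "0 < Re (1 - b * z)" if "cmod z < 1" for z
    using complex_Re_le_cmod[of "b * z"] mult_right_mono[OF assms norm_ge_zero[of z]] that
    by (simp add: norm_mult)
  have "continuous_on (cball 0 1) (\<lambda>z. 1 - b * z)" by (intro continuous_intros)
  moreover have "(\<lambda>z. 1 - b * z) ` cball 0 1 \<subseteq> {z. 0 \<le> Re z}"
    using Re by (simp add: image_subset_iff del: minus_complex.sel times_complex.sel)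
  ultimately have "continuous_on (cball 0 1) (\<lambda>z. csqrt (1 - b * z))"
    by (rule continuous_on_compose2[OF continuous_on_csqrt_right_half_plane])
  moreover have "1 - b * z \<notin> \<real>\<^sub>\<le>\<^sub>0" if "z \<in> ball 0 1" for z
    using pos[of z] that by (simp add: complex_nonpos_Reals_iff del: minus_complex.sel times_complex.sel)
  hence "(\<lambda>z. csqrt (1 - b * z)) holomorphic_on ball 0 1"
    by (intro holomorphic_on_csqrt' holomorphic_intros)
  ultimately show ?thesis by (simp add: disc_algebra_def)
qed

lemma norm_csqrt_square: "(cmod (csqrt z))\<^sup>2 = cmod z"
  by (metis norm_power power2_csqrt)

text \<open>
  If \<open>a\<close> is not in the open disc, \<open>z - a = - a * (1 - z / a)\<close> has a square root there. If \<open>a\<close> is in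
  the open disc, \<open>z - a\<close> is the product of the Blaschke factor \<open>(z - a) / (1 - cnj a * z)\<close>, which has
  modulus \<open>1\<close> on the circle, and of \<open>1 - cnj a * z\<close>, which has a square root.
\<close>

lemma balanced_factorization_linear:
  "\<exists>g h. balanced_factorization (\<lambda>z. z - a) g h"
proof (cases "cmod a < 1")
  case False
  hence a: "a \<noteq> 0" "cmod (1 / a) \<le> 1" by (auto simp: norm_divide divide_simps)
  define g where "g = (\<lambda>z. csqrt (- a) * csqrt (1 - 1 / a * z))"
  have "g \<in> disc_algebra"
    unfolding g_def by (intro disc_algebra_mult csqrt_linear_in_disc_algebra a) (simp add: disc_algebra_def)
  moreover have sq: "g z * g z = z - a" for z
  proof -
    have "g z * g z = (csqrt (- a))\<^sup>2 * (csqrt (1 - 1 / a * z))\<^sup>2"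
      by (simp add: g_def power2_eq_square mult_ac)
    also have "\<dots> = z - a" using a by (simp add: field_simps)
    finally show ?thesis .
  qed
  moreover have "(cmod (g z))\<^sup>2 = cmod (z - a)" for z
    by (metis sq norm_mult power2_eq_square)
  ultimately have "balanced_factorization (\<lambda>z. z - a) g g"
    by (simp add: balanced_factorization_def)
  thus ?thesis by blast
next
  case True
  define s where "s = (\<lambda>z. csqrt (1 - cnj a * z))"
  have s: "s \<in> disc_algebra" unfolding s_def using True by (intro csqrt_linear_in_disc_algebra) simp
  have nz: "s z \<noteq> 0" if "cmod z \<le> 1" for z
  proof -
    have "cmod (cnj a * z) < 1"
      using True that mult_left_mono[OF that norm_ge_zero[of a]] by (simp add: norm_mult)
    hence "cnj a * z \<noteq> 1" by auto
    thus ?thesis by (auto simp: s_def)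
  qed
  have "(\<lambda>z. (z - a) / s z) \<in> disc_algebra"
    using s nz unfolding disc_algebra_def by (auto intro!: continuous_intros holomorphic_intros)
  moreover have circle: "(cmod (s z))\<^sup>2 = cmod (z - a)" if "cmod z = 1" for z
  proof -
    have "z * cnj z = 1" using that by (metis complex_norm_square of_real_1 power_one)
    hence "z - a = z * cnj (1 - cnj a * z)" by (simp add: algebra_simps)
    thus ?thesis using that unfolding s_def norm_csqrt_square by (metis complex_mod_cnj mult_1 norm_mult)
  qed
  moreover have "(cmod ((z - a) / s z))\<^sup>2 = cmod (z - a)" if "cmod z = 1" for z
    using circle[OF that] nz[of z] that
    by (simp add: norm_divide power_divide) (auto simp: power2_eq_square)
  ultimately have "balanced_factorization (\<lambda>z. z - a) s (\<lambda>z. (z - a) / s z)"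
    using s nz by (simp add: balanced_factorization_def)
  thus ?thesis by blast
qed

lemma balanced_factorization_poly:
  "\<exists>g h. balanced_factorization (poly P) g h"
proof (induction "degree P" arbitrary: P)
  case 0
  then obtain c where c: "P = [:c:]" by (auto elim: degree_eq_zeroE)
  have "csqrt c * csqrt c = c" by (metis power2_csqrt power2_eq_square)
  hence "balanced_factorization (poly P) (\<lambda>_. csqrt c) (\<lambda>_. csqrt c)"
    by (simp add: balanced_factorization_def disc_algebra_def norm_csqrt_square c)
  thus ?case by blast
next
  case (Suc n)
  obtain a where "poly P a = 0" using alg_closed_imp_poly_has_root[of P] Suc(2) by auto
  then obtain Q where Q: "P = [:- a, 1:] * Q" by (auto simp: poly_eq_0_iff_dvd)
  have "Q \<noteq> 0" using Q Suc(2) by auto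
  hence "degree P = 1 + degree Q" unfolding Q by (subst degree_mult_eq) auto
  hence "n = degree Q" using Suc(2) by simp
  then obtain g h k l where "balanced_factorization (poly Q) g h"
      "balanced_factorization (\<lambda>z. z - a) k l"
    using Suc(1) balanced_factorization_linear by blast
  from balanced_factorization_mult[OF this(2,1)]
  moreover have "poly P = (\<lambda>z. (z - a) * poly Q z)" by (simp add: Q fun_eq_iff algebra_simps)
  ultimately have "balanced_factorization (poly P) (\<lambda>z. k z * g z) (\<lambda>z. l z * h z)" by simp
  thus ?case by blast
qed

section \<open>Taylor coefficients as Fourier coefficients\<close>

definition taylor_coeff :: "(complex \<Rightarrow> complex) \<Rightarrow> nat \<Rightarrow> complex" where
  "taylor_coeff f k = (deriv ^^ k) f 0 / fact k"

lemma taylor_coeff_mult: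
  assumes "g holomorphic_on ball 0 1" "h holomorphic_on ball 0 1"
    and "\<And>z. z \<in> ball 0 1 \<Longrightarrow> F z = g z * h z"
  shows "taylor_coeff F n = (\<Sum>k\<le>n. taylor_coeff g k * taylor_coeff h (n - k))"
proof -
  have "eventually (\<lambda>z. F z = g z * h z) (nhds 0)"
    using assms(3) eventually_nhds_in_open[of "ball 0 1" "0::complex"] by (auto elim!: eventually_mono)
  hence "(deriv ^^ n) F 0 = (deriv ^^ n) (\<lambda>z. g z * h z) 0"
    by (rule higher_deriv_cong_ev) simp
  also have "\<dots> = (\<Sum>k=0..n. of_nat (n choose k) * (deriv ^^ k) g 0 * (deriv ^^ (n - k)) h 0)"
    by (rule higher_deriv_mult[OF assms(1,2)]) auto
  finally have "taylor_coeff F n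
      = (\<Sum>k\<le>n. of_nat (n choose k) * (deriv ^^ k) g 0 * (deriv ^^ (n - k)) h 0 / fact n)"
    by (simp add: taylor_coeff_def sum_divide_distrib atLeast0AtMost)
  also have "\<dots> = (\<Sum>k\<le>n. taylor_coeff g k * taylor_coeff h (n - k))"
    by (intro sum.cong) (auto simp: taylor_coeff_def binomial_fact)
  finally show ?thesis .
qed

lemma deriv_poly: "deriv (poly P) = poly (pderiv P)" for P :: "complex poly"
  by (rule ext) (rule DERIV_imp_deriv[OF poly_DERIV])

lemma taylor_coeff_poly: "taylor_coeff (poly P) n = coeff P n"
proof -
  have "(deriv ^^ n) (poly P) = poly ((pderiv ^^ n) P)"
    by (induction n) (auto simp: deriv_poly)
  thus ?thesis
    by (simp add: taylor_coeff_def poly_0_coeff_0 coeff_higher_pderiv flip: pochhammer_fact)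
qed

text \<open>
  Cauchy's formula for the derivatives at \<open>0\<close>, used on the unit circle itself: the square roots
  need not extend holomorphically beyond the closed disc.
\<close>

lemma taylor_coeff_eq_circle_integral:
  assumes "g \<in> disc_algebra"
  shows "(\<integral>\<theta>. g (cis (2 * pi * \<theta>)) * cnj (cis (2 * pi * \<theta>) ^ k) \<partial>lebesgue_on {0..1}) = taylor_coeff g k"
proof -
  have g: "continuous_on (cball 0 1) g" "g holomorphic_on ball 0 1"
    using assms by (auto simp: disc_algebra_def)
  have "((\<lambda>z. g z / (z - 0) ^ Suc k) has_contour_integral (2 * pi * \<i>) / fact k * (deriv ^^ k) g 0) (circlepath 0 1)"
    by (rule Cauchy_has_contour_integral_higher_derivative_circlepath[OF g]) simp
  hence "((\<lambda>\<theta>. g (circlepath 0 1 \<theta>) / circlepath 0 1 \<theta> ^ Suc k * vector_derivative (circlepath 0 1) (at \<theta>))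
      has_integral 2 * pi * \<i> * taylor_coeff g k) {0..1}"
    by (simp add: has_contour_integral taylor_coeff_def)
  also have "(\<lambda>\<theta>. g (circlepath 0 1 \<theta>) / circlepath 0 1 \<theta> ^ Suc k * vector_derivative (circlepath 0 1) (at \<theta>))
      = (\<lambda>\<theta>. 2 * pi * \<i> * (g (cis (2 * pi * \<theta>)) * cnj (cis (2 * pi * \<theta>) ^ k)))" (is "?l = ?r")
  proof
    fix \<theta> :: real
    have c: "circlepath 0 1 \<theta> = cis (2 * pi * \<theta>)"
      by (simp add: circlepath_def part_circlepath_def cis_conv_exp mult_ac linepath_def)
    have "exp (2 * of_real pi * \<i> * \<theta>) = cis (2 * pi * \<theta>)" by (simp add: cis_conv_exp mult_ac)
    moreover have "inverse (cis (2 * pi * \<theta>)) = cnj (cis (2 * pi * \<theta>))" by (simp add: cis_cnj)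
    ultimately show "?l \<theta> = ?r \<theta>" unfolding c vector_derivative_circlepath
      by (simp add: divide_inverse power_inverse[symmetric] mult_ac cis_cnj cis_mult)
  qed
  finally have "((\<lambda>\<theta>. 1 / (2 * pi * \<i>) * (2 * pi * \<i> * (g (cis (2 * pi * \<theta>)) * cnj (cis (2 * pi * \<theta>) ^ k))))
      has_integral 1 / (2 * pi * \<i>) * (2 * pi * \<i> * taylor_coeff g k)) {0..1}"
    by (rule has_integral_mult_right)
  hence "((\<lambda>\<theta>. g (cis (2 * pi * \<theta>)) * cnj (cis (2 * pi * \<theta>) ^ k)) has_integral taylor_coeff g k) {0..1}"
    by simp
  moreover have "integrable (lebesgue_on {0..1}) (\<lambda>\<theta>. g (cis (2 * pi * \<theta>)) * cnj (cis (2 * pi * \<theta>) ^ k))"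
    by (intro continuous_imp_integrable_real continuous_intros continuous_on_compose2[OF g(1)]) auto
  ultimately show ?thesis
    by (simp add: lebesgue_integral_eq_integral integral_unique)
qed

interpretation circle: orthonormal_sequence "lebesgue_on {0..1::real}" "\<lambda>k \<theta>. cis (2 * pi * \<theta>) ^ k"
proof (intro orthonormal_sequence.intro orthonormal_sequence_axioms.intro finite_measureI)
  show "emeasure (lebesgue_on {0..1}) (space (lebesgue_on {0..1::real})) \<noteq> \<infinity>"
    by (simp add: emeasure_restrict_space)
  show "(\<lambda>\<theta>. cis (2 * pi * \<theta>) ^ k) \<in> borel_measurable (lebesgue_on {0..1})" for k
    by (intro continuous_imp_measurable_on_sets_lebesgue continuous_intros) auto
  show "(\<integral>\<theta>. cis (2 * pi * \<theta>) ^ j * cnj (cis (2 * pi * \<theta>) ^ k) \<partial>lebesgue_on {0..1})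
      = (if j = k then 1 else 0)" for j k
  proof -
    have "(\<lambda>z. z ^ j) \<in> disc_algebra" by (auto simp: disc_algebra_def intro!: continuous_intros holomorphic_intros)
    moreover have "poly (monom 1 j) = (\<lambda>z::complex. z ^ j)" by (simp add: fun_eq_iff poly_monom)
    ultimately show ?thesis
      using taylor_coeff_eq_circle_integral[of "\<lambda>z. z ^ j" k] taylor_coeff_poly[of "monom 1 j" k]
      by simp
  qed
qed (simp add: norm_power)

section \<open>Paley's inequality for polynomials\<close>

lemma dyadic_blocks_le:
  fixes a :: "nat \<Rightarrow> real"
  assumes "\<And>k. 0 \<le> a k"
  shows "(\<Sum>i\<le>j. \<Sum>k | k \<le> 2 ^ i \<and> 2 ^ i \<le> 2 * k. a k) \<le> 2 * (\<Sum>k\<le>2 ^ j. a k)"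
proof -
  have fin: "finite {k. k \<le> m \<and> P k}" for m :: nat and P by simp
  \<comment> \<open>The second sum ends where the last block begins, so it is disjoint from the next block and
    the two together fit into the next initial segment.\<close>
  have "(\<Sum>i\<le>j. \<Sum>k | k \<le> 2 ^ i \<and> 2 ^ i \<le> 2 * k. a k)
      \<le> (\<Sum>k\<le>2 ^ j. a k) + (\<Sum>k | 2 * k \<le> 2 ^ j. a k)"
  proof (induction j)
    case 0
    have "(\<Sum>k | k \<le> 1 \<and> 1 \<le> 2 * k. a k) \<le> (\<Sum>k\<le>1. a k)"
      using assms by (intro sum_mono2) auto
    moreover have "0 \<le> (\<Sum>k | 2 * k \<le> 1. a k)" by (intro sum_nonneg assms)
    ultimately show ?case by simp
  next
    case (Suc j)
    have half: "finite {k::nat. 2 * k \<le> 2 ^ j}" by (rule finite_subset[of _ "{..2 ^ j}"]) auto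
    have "(\<Sum>k | k \<le> 2 ^ Suc j \<and> 2 ^ Suc j \<le> 2 * k. a k) + (\<Sum>k | 2 * k \<le> 2 ^ j. a k)
        = (\<Sum>k\<in>{k. k \<le> 2 ^ Suc j \<and> 2 ^ Suc j \<le> 2 * k} \<union> {k. 2 * k \<le> 2 ^ j}. a k)"
    proof (rule sum.union_disjoint[symmetric])
      show "{k. k \<le> 2 ^ Suc j \<and> 2 ^ Suc j \<le> 2 * k} \<inter> {k::nat. 2 * k \<le> 2 ^ j} = {}"
      proof (rule equals0I)
        fix k :: nat
        assume "k \<in> {k. k \<le> 2 ^ Suc j \<and> 2 ^ Suc j \<le> 2 * k} \<inter> {k. 2 * k \<le> 2 ^ j}"
        moreover have "(0::nat) < 2 ^ j" by simp
        ultimately show False unfolding Int_iff mem_Collect_eq power_Suc by linarith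
      qed
    qed (use fin half in auto)
    also have "\<dots> \<le> (\<Sum>k\<le>2 ^ Suc j. a k)"
      using assms by (intro sum_mono2) auto
    finally have "(\<Sum>k | k \<le> 2 ^ Suc j \<and> 2 ^ Suc j \<le> 2 * k. a k) + (\<Sum>k | 2 * k \<le> 2 ^ j. a k)
        \<le> (\<Sum>k\<le>2 ^ Suc j. a k)" .
    moreover have "{k::nat. 2 * k \<le> 2 ^ Suc j} = {..2 ^ j}" by auto
    ultimately show ?case using Suc.IH by simp
  qed
  also have "(\<Sum>k | 2 * k \<le> 2 ^ j. a k) \<le> (\<Sum>k\<le>2 ^ j. a k)"
    using assms by (intro sum_mono2) auto
  finally show ?thesis by simp
qed

text \<open>
  If \<open>k\<close> is not in the upper half \<open>U\<close> of the range then \<open>n - k\<close> is. Cauchy-Schwarz is applied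
  separately to the indices in \<open>U\<close> and to the remaining ones.
\<close>

lemma convolution_norm_le:
  fixes a b :: "nat \<Rightarrow> complex" and n :: nat
  defines "U \<equiv> {k. k \<le> n \<and> n \<le> 2 * k}"
  shows "(cmod (\<Sum>k\<le>n. a k * b (n - k)))\<^sup>2
      \<le> 2 * ((\<Sum>k\<in>U. (cmod (a k))\<^sup>2) * (\<Sum>k\<le>n. (cmod (b k))\<^sup>2))
        + 2 * ((\<Sum>k\<le>n. (cmod (a k))\<^sup>2) * (\<Sum>k\<in>U. (cmod (b k))\<^sup>2))"
proof -
  define s where "s V = (\<Sum>k\<in>V. cmod (a k) * cmod (b (n - k)))" for V
  have U: "U \<subseteq> {..n}" "finite U" by (auto simp: U_def)
  have refl: "(\<Sum>k\<in>V. (cmod (b (n - k)))\<^sup>2) \<le> (\<Sum>k\<in>W. (cmod (b k))\<^sup>2)"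
    if "V \<subseteq> {..n}" "(\<lambda>k. n - k) ` V \<subseteq> W" "finite W" for V W
  proof -
    have "inj_on (\<lambda>k. n - k) V"
      using that(1) by (intro inj_onI) (metis atMost_iff diff_diff_cancel subsetD)
    hence "(\<Sum>k\<in>V. (cmod (b (n - k)))\<^sup>2) = (\<Sum>k\<in>(\<lambda>k. n - k) ` V. (cmod (b k))\<^sup>2)"
      by (simp add: sum.reindex)
    also have "\<dots> \<le> (\<Sum>k\<in>W. (cmod (b k))\<^sup>2)" using that by (intro sum_mono2) auto
    finally show ?thesis .
  qed
  have "cmod (\<Sum>k\<le>n. a k * b (n - k)) \<le> s {..n}"
    unfolding s_def by (rule sum_norm_le) (simp add: norm_mult)
  also have "\<dots> = s U + s ({..n} - U)"
    unfolding s_def using U sum.subset_diff[of U "{..n}"] by (simp add: add.commute)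
  finally have "(cmod (\<Sum>k\<le>n. a k * b (n - k)))\<^sup>2 \<le> (s U + s ({..n} - U))\<^sup>2"
    by (rule power_mono) simp
  also have "\<dots> \<le> 2 * (s U)\<^sup>2 + 2 * (s ({..n} - U))\<^sup>2"
    using sum_squares_bound[of "s U" "s ({..n} - U)"] by (simp add: power2_sum)
  also have "(s U)\<^sup>2 \<le> (\<Sum>k\<in>U. (cmod (a k))\<^sup>2) * (\<Sum>k\<in>U. (cmod (b (n - k)))\<^sup>2)"
    unfolding s_def by (rule Cauchy_Schwarz_ineq_sum)
  also have "\<dots> \<le> (\<Sum>k\<in>U. (cmod (a k))\<^sup>2) * (\<Sum>k\<le>n. (cmod (b k))\<^sup>2)"
    using U by (intro mult_left_mono refl sum_nonneg) auto
  also have "(s ({..n} - U))\<^sup>2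
      \<le> (\<Sum>k\<in>{..n} - U. (cmod (a k))\<^sup>2) * (\<Sum>k\<in>{..n} - U. (cmod (b (n - k)))\<^sup>2)"
    unfolding s_def by (rule Cauchy_Schwarz_ineq_sum)
  also have "\<dots> \<le> (\<Sum>k\<le>n. (cmod (a k))\<^sup>2) * (\<Sum>k\<in>U. (cmod (b k))\<^sup>2)"
    using U by (intro mult_mono refl sum_mono2 sum_nonneg) (auto simp: U_def)
  finally show ?thesis by simp
qed

lemma continuous_on_growth_norm:
  fixes u :: "'a::topological_space \<Rightarrow> 'b::real_normed_vector"
  assumes "growth_function p \<Psi>" "continuous_on A u"
  shows "continuous_on A (\<lambda>x. \<Psi> (norm (u x)))"
proof (rule continuous_on_compose2[where g = \<Psi> and f = "\<lambda>x. norm (u x)"])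
  show "continuous_on {0..} \<Psi>" using assms(1) by (simp add: growth_function_def)
  show "continuous_on A (\<lambda>x. norm (u x))" using assms(2) by (rule continuous_on_norm)
qed auto

lemma weighted_energy_disc_algebra_le:
  assumes gf: "growth_function p \<Psi>"
    and C: "tail_constant \<Psi> C"
    and g: "g \<in> disc_algebra"
    and K: "(\<integral>\<theta>. \<Psi> ((cmod (g (cis (2 * pi * \<theta>))))\<^sup>2) \<partial>lebesgue_on {0..1}) \<le> K"
  shows "abel_sum (paley_weight \<Psi>) (\<lambda>j. \<Sum>k\<le>2 ^ j. (cmod (taylor_coeff g k))\<^sup>2) N \<le> 2 * K + 4 * (C * K)\<^sup>2"
proof -
  define u where "u = (\<lambda>\<theta>. g (cis (2 * pi * \<theta>)))"
  have "continuous_on (cball 0 1) g" using g by (simp add: disc_algebra_def)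
  hence cont: "continuous_on {0..1} u"
    unfolding u_def by (rule continuous_on_compose2) (auto intro!: continuous_intros)
  hence "compact (u ` {0..1})" by (intro compact_continuous_image) auto
  then obtain B where B: "\<And>\<theta>. \<theta> \<in> {0..1} \<Longrightarrow> cmod (u \<theta>) \<le> B"
    using compact_imp_bounded bounded_iff by (metis imageI)
  have coef: "circle.coef u k = taylor_coeff g k" for k
    unfolding circle.coef_def u_def by (rule taylor_coeff_eq_circle_integral[OF g])
  have "continuous_on {0..1} (\<lambda>\<theta>. \<Psi> (norm ((u \<theta>)\<^sup>2)))"
    by (intro continuous_on_growth_norm[OF gf] continuous_intros cont)
  hence "integrable (lebesgue_on {0..1}) (\<lambda>\<theta>. \<Psi> ((cmod (u \<theta>))\<^sup>2))"
    by (intro continuous_imp_integrable_real) (simp add: norm_power)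
  moreover have "u \<in> borel_measurable (lebesgue_on {0..1})"
    by (intro continuous_imp_measurable_on_sets_lebesgue cont) auto
  ultimately show ?thesis
    using circle.weighted_energy_le[OF gf C, of u B K N] B K
    by (simp add: coef) (simp add: u_def)
qed

text \<open>
  For each of the two factors, the weighted energy bound controls every single
  \<open>paley_weight \<Psi> j * A j\<close>, as the last term of a summation by parts, and also the sum of the
  \<open>paley_weight \<Psi> j * D j\<close>, since the partial sums of \<open>D\<close> are at most \<open>2 * A\<close>. Two powers of the
  weight are available for the products in \<open>convolution_norm_le\<close>, one for each factor.
\<close>

lemma paley_inequality_poly:
  assumes gf: "growth_function p \<Psi>"
    and C: "tail_constant \<Psi> C"
    and K: "(\<integral>\<theta>. \<Psi> (cmod (poly P (cis (2 * pi * \<theta>)))) \<partial>lebesgue_on {0..1}) \<le> K"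
  shows "(\<Sum>j\<le>N. (paley_weight \<Psi> j)\<^sup>2 * (cmod (coeff P (2 ^ j)))\<^sup>2) \<le> 8 * (2 * K + 4 * (C * K)\<^sup>2)\<^sup>2"
proof -
  define E where "E = 2 * K + 4 * (C * K)\<^sup>2"
  define w where "w = paley_weight \<Psi>"
  define A where "A g j = (\<Sum>k\<le>2 ^ j. (cmod (taylor_coeff g k))\<^sup>2)" for g and j :: nat
  define D where "D g j = (\<Sum>k | k \<le> 2 ^ j \<and> 2 ^ j \<le> 2 * k. (cmod (taylor_coeff g k))\<^sup>2)"
    for g and j :: nat
  have w: "decseq w" "0 \<le> w j" for j
    using decseq_paley_weight[OF gf] paley_weight_pos[OF gf] by (auto simp: w_def less_imp_le)
  have A0: "0 \<le> A g j" and D0: "0 \<le> D g j" for g j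
    by (auto simp: A_def D_def intro!: sum_nonneg)
  obtain g h where gh: "balanced_factorization (poly P) g h"
    using balanced_factorization_poly by blast
  have factor_bounds: "w j * A q j \<le> E" "(\<Sum>j\<le>N. w j * D q j) \<le> 2 * E" if "q = g \<or> q = h" for q j
  proof -
    have q: "q \<in> disc_algebra" "\<And>z. cmod z = 1 \<Longrightarrow> (cmod (q z))\<^sup>2 = cmod (poly P z)"
      using gh that by (auto simp: balanced_factorization_def)
    have E: "abel_sum w (A q) N \<le> E" for N
      unfolding w_def A_def E_def
      by (rule weighted_energy_disc_algebra_le[OF gf C q(1)]) (use K q(2) in simp_all)
    show "w j * A q j \<le> E"
      using last_term_le_abel_sum[OF w(1), of "A q" j] A0 E[of j] by simp
    have "(\<Sum>j\<le>N. w j * D q j) = abel_sum w (\<lambda>j. \<Sum>i\<le>j. D q i) N"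
      by (simp add: abel_sum_partial_sums)
    also have "\<dots> \<le> abel_sum w (\<lambda>j. 2 * A q j) N"
      unfolding A_def D_def by (intro abel_sum_mono w dyadic_blocks_le) simp
    also have "\<dots> \<le> 2 * E" using E[of N] by (simp add: abel_sum_cmult)
    finally show "(\<Sum>j\<le>N. w j * D q j) \<le> 2 * E" .
  qed
  have "0 \<le> E" using factor_bounds(1)[of g 0] mult_nonneg_nonneg[OF w(2)[of 0] A0[of g 0]] by simp
  have "(w j)\<^sup>2 * (cmod (coeff P (2 ^ j)))\<^sup>2 \<le> 2 * E * (w j * D g j + w j * D h j)" for j
  proof -
    have "coeff P (2 ^ j) = (\<Sum>k\<le>2 ^ j. taylor_coeff g k * taylor_coeff h (2 ^ j - k))"
      unfolding taylor_coeff_poly[symmetric]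
      by (rule taylor_coeff_mult)
        (use gh in \<open>auto simp: balanced_factorization_def disc_algebra_def\<close>)
    hence "(cmod (coeff P (2 ^ j)))\<^sup>2 \<le> 2 * (D g j * A h j) + 2 * (A g j * D h j)"
      using convolution_norm_le[of "taylor_coeff g" "taylor_coeff h" "2 ^ j"]
      by (simp add: A_def D_def)
    hence "(w j)\<^sup>2 * (cmod (coeff P (2 ^ j)))\<^sup>2
        \<le> (w j)\<^sup>2 * (2 * (D g j * A h j) + 2 * (A g j * D h j))"
      by (rule mult_left_mono) simp
    also have "\<dots> = 2 * ((w j * D g j) * (w j * A h j) + (w j * A g j) * (w j * D h j))"
      by (simp add: power2_eq_square algebra_simps)
    also have "\<dots> \<le> 2 * ((w j * D g j) * E + E * (w j * D h j))"
      using factor_bounds(1) w D0 by (intro mult_left_mono add_mono mult_right_mono) auto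
    finally show ?thesis by (simp add: algebra_simps)
  qed
  hence "(\<Sum>j\<le>N. (w j)\<^sup>2 * (cmod (coeff P (2 ^ j)))\<^sup>2)
      \<le> (\<Sum>j\<le>N. 2 * E * (w j * D g j + w j * D h j))"
    by (rule sum_mono)
  also have "\<dots> = 2 * E * ((\<Sum>j\<le>N. w j * D g j) + (\<Sum>j\<le>N. w j * D h j))"
    by (simp only: sum_distrib_left[symmetric] sum.distrib)
  also have "\<dots> \<le> 2 * E * (2 * E + 2 * E)"
    using factor_bounds(2) \<open>0 \<le> E\<close> by (intro mult_left_mono add_mono) auto
  also have "\<dots> = 8 * E\<^sup>2" by (simp add: power2_eq_square)
  finally show ?thesis by (simp add: w_def E_def)
qed

section \<open>From polynomials to Hardy-Orlicz functions\<close>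

lemma nn_integral_circle_eq:
  fixes v :: "real \<Rightarrow> real"
  assumes "continuous_on UNIV v" "\<And>\<theta>. 0 \<le> v \<theta>"
  shows "(\<integral>\<^sup>+\<theta>\<in>{0..<1}. ennreal (v \<theta>) \<partial>lborel) = ennreal (\<integral>\<theta>. v \<theta> \<partial>lebesgue_on {0..1})"
proof -
  have "(\<integral>\<^sup>+\<theta>\<in>{0..<1}. ennreal (v \<theta>) \<partial>lborel) = (\<integral>\<^sup>+\<theta>\<in>{0..1}. ennreal (v \<theta>) \<partial>lborel)"
    using AE_lborel_singleton[of "1::real"]
    by (intro nn_integral_cong_AE) (auto elim!: eventually_mono split: split_indicator)
  also have "\<dots> = (\<integral>\<^sup>+\<theta>\<in>{0..1}. ennreal (v \<theta>) \<partial>lebesgue)"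
    by (rule nn_integral_completion[symmetric])
  also have "\<dots> = (\<integral>\<^sup>+\<theta>. ennreal (v \<theta>) \<partial>lebesgue_on {0..1})"
    by (rule nn_integral_restrict_space[symmetric]) simp
  also have "\<dots> = ennreal (\<integral>\<theta>. v \<theta> \<partial>lebesgue_on {0..1})"
    using assms by (intro nn_integral_eq_integral continuous_imp_integrable_real)
      (auto intro: continuous_on_subset)
  finally show ?thesis .
qed

lemma continuous_on_circle_growth:
  assumes "growth_function p \<Psi>" "F holomorphic_on ball 0 1" "0 \<le> r" "r < 1"
  shows "continuous_on UNIV (\<lambda>\<theta>::real. \<Psi> (cmod (F (of_real r * cis (2 * pi * \<theta>)))))"
proof (rule continuous_on_growth_norm[OF assms(1)])
  show "continuous_on UNIV (\<lambda>\<theta>::real. F (of_real r * cis (2 * pi * \<theta>)))"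
    by (rule continuous_on_compose2[OF holomorphic_on_imp_continuous_on[OF assms(2)]])
       (use assms(3,4) in \<open>auto intro!: continuous_intros simp: norm_mult\<close>)
qed

text \<open>
  The bound is that of the polynomial case with \<open>K = 2\<close>: the circle means of the Taylor polynomials
  converge to a limit that is at most \<open>1\<close>, so they are eventually below \<open>2\<close>.
\<close>

lemma paley_inequality_circle:
  assumes gf: "growth_function p \<Psi>"
    and C: "tail_constant \<Psi> C"
    and F: "F holomorphic_on ball 0 1" "\<And>z. z \<in> ball 0 1 \<Longrightarrow> (\<lambda>n. f n * z ^ n) sums F z"
    and le1: "circle_mean_sup \<Psi> F \<le> 1"
    and r: "0 < r" "r < 1"
  shows "(\<Sum>j\<le>N. (paley_weight \<Psi> j)\<^sup>2 * (cmod (f (2 ^ j) * of_real r ^ 2 ^ j))\<^sup>2)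
           \<le> 8 * (4 + 16 * C\<^sup>2)\<^sup>2"
proof -
  define P where "P m = (\<Sum>n<m. monom (f n * of_real r ^ n) n)" for m
  have coeffP: "coeff (P m) k = (if k < m then f k * of_real r ^ k else 0)" for m k
    by (simp add: P_def coeff_sum)
  have polyP: "poly (P m) z = (\<Sum>n<m. f n * (of_real r * z) ^ n)" for m z
    by (simp add: P_def poly_sum poly_monom power_mult_distrib mult_ac)
  have conv: "(\<lambda>m. poly (P m) z) \<longlonglongrightarrow> F (of_real r * z)" if "cmod z = 1" for z
    unfolding polyP using F(2)[of "of_real r * z"] r that by (simp add: sums_def norm_mult)
  obtain \<rho> where \<rho>: "r < \<rho>" "\<rho> < 1" using dense[OF r(2)] by blast
  have abs: "summable (\<lambda>n. cmod (f n * of_real r ^ n))"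
    using powser_insidea[of f "of_real \<rho>" "of_real r"] sums_summable[OF F(2)[of "of_real \<rho>"]] r \<rho>
    by simp
  define B where "B = (\<Sum>n. cmod (f n * of_real r ^ n))"
  have PB: "cmod (poly (P m) z) \<le> B" if "cmod z = 1" for m z
  proof -
    have "cmod (poly (P m) z) \<le> (\<Sum>n<m. cmod (f n * of_real r ^ n))"
      unfolding polyP using that by (intro sum_norm_le) (simp add: norm_mult norm_power)
    also have "\<dots> \<le> B" unfolding B_def by (rule sum_le_suminf[OF abs]) auto
    finally show ?thesis .
  qed
  define v where "v = (\<lambda>\<theta>. \<Psi> (cmod (F (of_real r * cis (2 * pi * \<theta>)))))"
  define I where "I m = (\<integral>\<theta>. \<Psi> (cmod (poly (P m) (cis (2 * pi * \<theta>)))) \<partial>lebesgue_on {0..1})" for m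
  have v_cont: "continuous_on UNIV v"
    unfolding v_def using r by (intro continuous_on_circle_growth[OF gf F(1)]) auto
  have "I \<longlonglongrightarrow> (\<integral>\<theta>. v \<theta> \<partial>lebesgue_on {0..1})"
    unfolding I_def
  proof (rule integral_dominated_convergence[where w = "\<lambda>_. \<Psi> B"])
    show "v \<in> borel_measurable (lebesgue_on {0..1})"
      using continuous_on_subset[OF v_cont, of "{0..1}"]
      by (intro continuous_imp_measurable_on_sets_lebesgue) auto
    show "(\<lambda>\<theta>. \<Psi> (cmod (poly (P m) (cis (2 * pi * \<theta>))))) \<in> borel_measurable (lebesgue_on {0..1})" for m
      by (intro continuous_imp_measurable_on_sets_lebesgue continuous_on_growth_norm[OF gf]
          continuous_intros) auto
    show "integrable (lebesgue_on {0..1}) (\<lambda>_::real. \<Psi> B)"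
      by (rule circle.integrable_const)
    show "AE \<theta> in lebesgue_on {0..1}. (\<lambda>m. \<Psi> (cmod (poly (P m) (cis (2 * pi * \<theta>))))) \<longlonglongrightarrow> v \<theta>"
    proof (rule AE_I2)
      fix \<theta> :: real
      have "continuous_on {0..} \<Psi>" using gf by (simp add: growth_function_def)
      thus "(\<lambda>m. \<Psi> (cmod (poly (P m) (cis (2 * pi * \<theta>))))) \<longlonglongrightarrow> v \<theta>"
        unfolding v_def
        by (rule continuous_on_tendsto_compose) (auto intro!: tendsto_norm conv)
    qed
    show "AE \<theta> in lebesgue_on {0..1}. norm (\<Psi> (cmod (poly (P m) (cis (2 * pi * \<theta>))))) \<le> \<Psi> B" for m
    proof (rule AE_I2)
      fix \<theta> :: real
      have "cmod (poly (P m) (cis (2 * pi * \<theta>))) \<le> B" by (rule PB) simp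
      thus "norm (\<Psi> (cmod (poly (P m) (cis (2 * pi * \<theta>))))) \<le> \<Psi> B"
        using growth_function_le_iff[OF gf norm_ge_zero[of "poly (P m) (cis (2 * pi * \<theta>))"], of B]
          growth_function_nonneg[OF gf norm_ge_zero[of "poly (P m) (cis (2 * pi * \<theta>))"]]
          norm_ge_zero[of "poly (P m) (cis (2 * pi * \<theta>))"] by auto
    qed
  qed
  moreover have "(\<integral>\<theta>. v \<theta> \<partial>lebesgue_on {0..1}) < 2"
  proof -
    have "ennreal (\<integral>\<theta>. v \<theta> \<partial>lebesgue_on {0..1}) = (\<integral>\<^sup>+\<theta>\<in>{0..<1}. ennreal (v \<theta>) \<partial>lborel)"
      using growth_function_nonneg[OF gf] by (intro nn_integral_circle_eq[symmetric] v_cont) (simp add: v_def)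
    also have "\<dots> \<le> circle_mean_sup \<Psi> F"
      unfolding circle_mean_sup_def v_def using r by (intro SUP_upper) auto
    also note le1
    finally have "(\<integral>\<theta>. v \<theta> \<partial>lebesgue_on {0..1}) \<le> 1" by simp
    thus ?thesis by simp
  qed
  ultimately have "eventually (\<lambda>m. I m < 2) sequentially" by (rule order_tendstoD(2))
  then obtain m where m: "2 ^ N < m" "I m < 2"
    using eventually_conj[OF _ eventually_gt_at_top[of "2 ^ N"]] eventually_happens'[OF sequentially_bot]
    by (metis (mono_tags, lifting))
  have "(\<Sum>j\<le>N. (paley_weight \<Psi> j)\<^sup>2 * (cmod (coeff (P m) (2 ^ j)))\<^sup>2) \<le> 8 * (2 * 2 + 4 * (C * 2)\<^sup>2)\<^sup>2"
    by (rule paley_inequality_poly[OF gf C]) (use m in \<open>simp_all add: I_def\<close>)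
  moreover have "2 ^ j < m" if "j \<le> N" for j
    by (rule le_less_trans[OF power_increasing[OF that] m(1)]) simp
  ultimately show ?thesis by (simp add: coeffP power_mult_distrib)
qed

lemma paley_inequality_unit:
  assumes gf: "growth_function p \<Psi>"
    and C: "tail_constant \<Psi> C"
    and F: "F holomorphic_on ball 0 1" "\<And>z. z \<in> ball 0 1 \<Longrightarrow> (\<lambda>n. f n * z ^ n) sums F z"
    and le1: "circle_mean_sup \<Psi> F \<le> 1"
  shows "(\<Sum>j\<le>N. (paley_weight \<Psi> j)\<^sup>2 * (cmod (f (2 ^ j)))\<^sup>2) \<le> 8 * (4 + 16 * C\<^sup>2)\<^sup>2"
proof (rule tendsto_upperbound)
  show "((\<lambda>r. \<Sum>j\<le>N. (paley_weight \<Psi> j)\<^sup>2 * (cmod (f (2 ^ j) * of_real r ^ 2 ^ j))\<^sup>2)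
      \<longlongrightarrow> (\<Sum>j\<le>N. (paley_weight \<Psi> j)\<^sup>2 * (cmod (f (2 ^ j)))\<^sup>2)) (at_left 1)"
    by (auto intro!: tendsto_eq_intros)
  show "eventually (\<lambda>r. (\<Sum>j\<le>N. (paley_weight \<Psi> j)\<^sup>2 * (cmod (f (2 ^ j) * of_real r ^ 2 ^ j))\<^sup>2)
      \<le> 8 * (4 + 16 * C\<^sup>2)\<^sup>2) (at_left 1)"
    using eventually_at_left_real[of 0 "1::real"]
    by (auto elim!: eventually_mono intro!: paley_inequality_circle[OF gf C F le1])
qed simp

text \<open>
  The norm is an infimum of real numbers, so it carries information only because the set is
  nonempty. By the lower type condition, dividing by a large \<open>\<alpha>\<close> multiplies the circle means by at
  most \<open>c * \<alpha> powr (- p)\<close>.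
\<close>

lemma hardy_orlicz_scaling:
  assumes gf: "growth_function p \<Psi>" and F: "F \<in> hardy_orlicz \<Psi>"
  shows "\<exists>\<alpha>>0. circle_mean_sup \<Psi> (\<lambda>z. F z / of_real \<alpha>) \<le> 1"
proof -
  obtain c where c: "c > 0" "\<And>t s. t \<ge> 0 \<Longrightarrow> s \<in> {0<..<1} \<Longrightarrow> \<Psi> (s * t) \<le> c * s powr p * \<Psi> t"
    using gf by (auto simp: growth_function_def lower_type_def)
  have p: "p > 0" using gf by (auto simp: growth_function_def)
  have hol: "F holomorphic_on ball 0 1" and "circle_mean_sup \<Psi> F < \<infinity>"
    using F by (auto simp: hardy_orlicz_def)
  then obtain K where K: "0 \<le> K" "circle_mean_sup \<Psi> F = ennreal K"
    by (cases "circle_mean_sup \<Psi> F") auto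
  define \<alpha> where "\<alpha> = (c * K + 2) powr (1 / p)"
  have ck: "0 \<le> c * K" using c K by simp
  have "\<alpha> > 1" unfolding \<alpha>_def using p ck by (intro gr_one_powr) auto
  hence \<alpha>: "1 / \<alpha> \<in> {0<..<1}" "\<alpha> > 0" by auto
  define b where "b = c * (1 / \<alpha>) powr p"
  have "\<alpha> powr p = c * K + 2" using ck p by (simp add: \<alpha>_def powr_powr)
  hence b: "b * K \<le> 1" "0 \<le> b" using \<alpha>(2) c ck by (auto simp: b_def powr_divide divide_simps)
  have "circle_mean_sup \<Psi> (\<lambda>z. F z / of_real \<alpha>) \<le> 1"
    unfolding circle_mean_sup_def
  proof (rule SUP_least)
    fix r :: real assume r: "r \<in> {0..<1}"
    define v where "v = (\<lambda>\<theta>. \<Psi> (cmod (F (of_real r * cis (2 * pi * \<theta>)))))"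
    have [measurable]: "v \<in> borel_measurable borel"
      unfolding v_def using r
      by (intro borel_measurable_continuous_onI continuous_on_circle_growth[OF gf hol]) auto
    have "(\<integral>\<^sup>+\<theta>\<in>{0..<1}. ennreal (\<Psi> (cmod (F (of_real r * cis (2 * pi * \<theta>)) / of_real \<alpha>))) \<partial>lborel)
        \<le> (\<integral>\<^sup>+\<theta>. ennreal b * (ennreal (v \<theta>) * indicator {0..<1} \<theta>) \<partial>lborel)"
    proof (rule nn_integral_mono)
      fix \<theta> :: real
      have "\<Psi> (cmod (F (of_real r * cis (2 * pi * \<theta>)) / of_real \<alpha>)) \<le> b * v \<theta>"
        using c(2)[OF norm_ge_zero \<alpha>(1), of "F (of_real r * cis (2 * pi * \<theta>))"] \<alpha>(2)
        by (simp add: v_def b_def norm_divide)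
      thus "ennreal (\<Psi> (cmod (F (of_real r * cis (2 * pi * \<theta>)) / of_real \<alpha>))) * indicator {0..<1} \<theta>
          \<le> ennreal b * (ennreal (v \<theta>) * indicator {0..<1} \<theta>)"
        using b(2) by (auto simp: ennreal_mult'[symmetric] intro!: ennreal_leI split: split_indicator)
    qed
    also have "\<dots> = ennreal b * (\<integral>\<^sup>+\<theta>\<in>{0..<1}. ennreal (v \<theta>) \<partial>lborel)"
      by (rule nn_integral_cmult) measurable
    also have "\<dots> \<le> ennreal b * circle_mean_sup \<Psi> F"
      unfolding circle_mean_sup_def v_def using r by (intro mult_left_mono SUP_upper) auto
    also have "\<dots> \<le> 1" using b K by (simp add: ennreal_mult[symmetric])
    finally show "(\<integral>\<^sup>+\<theta>\<in>{0..<1}. ennreal (\<Psi> (cmod (F (of_real r * cis (2 * pi * \<theta>)) / of_real \<alpha>))) \<partial>lborel) \<le> 1" .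
  qed
  thus ?thesis using \<alpha>(2) by blast
qed

theorem corollary4:
  fixes \<Psi> :: "real \<Rightarrow> real" and p :: real
  assumes "growth_function p \<Psi>" and "1/2 < p" and "p \<le> 1"
  shows "\<exists>B>0. \<forall>(F :: complex \<Rightarrow> complex) (f :: nat \<Rightarrow> complex).
           F \<in> hardy_orlicz \<Psi> \<longrightarrow>
           (\<forall>z\<in>ball 0 1. (\<lambda>n. f n * z ^ n) sums F z) \<longrightarrow>
           summable (\<lambda>j. (2 ^ j / growth_inv \<Psi> (2 ^ j))\<^sup>2 * (norm (f (2 ^ j)))\<^sup>2) \<and>
           sqrt (\<Sum>j. (2 ^ j / growth_inv \<Psi> (2 ^ j))\<^sup>2 * (norm (f (2 ^ j)))\<^sup>2)
             \<le> B * hardy_orlicz_norm \<Psi> F"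
proof -
  obtain C where C: "tail_constant \<Psi> C"
    using tail_constant_exists[OF assms(1,2)] by blast
  define B where "B = sqrt 8 * (4 + 16 * C\<^sup>2)"
  have "0 < B" by (simp add: B_def add_pos_nonneg)
  have B2: "B\<^sup>2 = 8 * (4 + 16 * C\<^sup>2)\<^sup>2" by (simp add: B_def power_mult_distrib)
  show ?thesis
  proof (intro exI[of _ B] conjI allI impI)
    fix F :: "complex \<Rightarrow> complex" and f :: "nat \<Rightarrow> complex"
    assume F: "F \<in> hardy_orlicz \<Psi>" and f: "\<forall>z\<in>ball 0 1. (\<lambda>n. f n * z ^ n) sums F z"
    define a where "a = (\<lambda>j. (2 ^ j / growth_inv \<Psi> (2 ^ j))\<^sup>2 * (norm (f (2 ^ j)))\<^sup>2)"
    define S where "S = {\<alpha>. \<alpha> > 0 \<and> circle_mean_sup \<Psi> (\<lambda>z. F z / of_real \<alpha>) \<le> 1}"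
    have a0: "0 \<le> a j" for j by (simp add: a_def)
    have partial: "(\<Sum>j<N. a j) \<le> (B * \<alpha>)\<^sup>2" if "\<alpha> \<in> S" for N \<alpha>
    proof -
      have \<alpha>: "\<alpha> > 0" "circle_mean_sup \<Psi> (\<lambda>z. F z / of_real \<alpha>) \<le> 1" using that by (auto simp: S_def)
      have "(\<Sum>j\<le>N. (paley_weight \<Psi> j)\<^sup>2 * (cmod (f (2 ^ j) / of_real \<alpha>))\<^sup>2) \<le> B\<^sup>2"
        unfolding B2
      proof (rule paley_inequality_unit[OF assms(1) C _ _ \<alpha>(2)])
        show "(\<lambda>z. F z / of_real \<alpha>) holomorphic_on ball 0 1"
          using F \<alpha>(1) by (auto simp: hardy_orlicz_def intro!: holomorphic_intros)
        show "(\<lambda>n. f n / of_real \<alpha> * z ^ n) sums (F z / of_real \<alpha>)" if "z \<in> ball 0 1" for z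
          using sums_divide[of _ _ "of_real \<alpha>", OF bspec[OF f that]] by simp
      qed
      hence "(\<Sum>j\<le>N. a j / \<alpha>\<^sup>2) \<le> B\<^sup>2"
        using \<alpha>(1) by (simp add: a_def paley_weight_def dyadic_level_def norm_divide power_divide)
      hence "(\<Sum>j\<le>N. a j) \<le> (B * \<alpha>)\<^sup>2"
        using \<alpha>(1) by (simp add: sum_divide_distrib[symmetric] power_mult_distrib divide_le_eq)
      moreover have "(\<Sum>j<N. a j) \<le> (\<Sum>j\<le>N. a j)" by (rule sum_mono2) (auto simp: a0)
      ultimately show ?thesis by linarith
    qed
    obtain \<alpha>0 where "\<alpha>0 \<in> S"
      using hardy_orlicz_scaling[OF assms(1) F] by (auto simp: S_def)
    have "summable a"
      by (rule summableI_nonneg_bounded[OF a0 partial[OF \<open>\<alpha>0 \<in> S\<close>]])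
    thus "summable (\<lambda>j. (2 ^ j / growth_inv \<Psi> (2 ^ j))\<^sup>2 * (norm (f (2 ^ j)))\<^sup>2)"
      by (simp add: a_def)
    have "sqrt (suminf a) / B \<le> \<alpha>" if "\<alpha> \<in> S" for \<alpha>
    proof -
      have "suminf a \<le> (B * \<alpha>)\<^sup>2"
        by (rule suminf_le_const[OF \<open>summable a\<close> partial[OF that]])
      hence "sqrt (suminf a) \<le> B * \<alpha>"
        using that \<open>0 < B\<close> by (intro real_le_lsqrt) (auto simp: S_def intro!: suminf_nonneg \<open>summable a\<close> a0)
      thus ?thesis using \<open>0 < B\<close> by (simp add: field_simps)
    qed
    hence "sqrt (suminf a) / B \<le> Inf S"
      using \<open>\<alpha>0 \<in> S\<close> by (intro cInf_greatest) auto
    hence "sqrt (suminf a) \<le> B * Inf S" using \<open>0 < B\<close> by (simp add: field_simps)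
    thus "sqrt (\<Sum>j. (2 ^ j / growth_inv \<Psi> (2 ^ j))\<^sup>2 * (norm (f (2 ^ j)))\<^sup>2)
        \<le> B * hardy_orlicz_norm \<Psi> F"
      unfolding a_def S_def hardy_orlicz_norm_def .
  qed (rule \<open>0 < B\<close>)
qed

end
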